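(* For every positive integer $n$, $$\int_{-\infty}^{\infty} \left( \frac{H_{n}(x)-H_{n}(0)}{x} \right)^{2} e^{-x^{2}}\, dx = \sqrt{\pi}\, n!\, 2^{n+1} \left[ 1 - \beta(n) \right],$$ where $H_n$ is the $n$-th (physicists') Hermite polynomial and $\beta(n)=0$ if $n$ is odd, $\beta(n) = 2^{-n}\binom{n}{n/2}$ if $n$ is even.
   Context: The Hermite polynomials $H_n(x)$ are the physicists' ones: $H_0(x)=1$, $H_1(x)=2x$, $H_{n+1}(x)=2xH_n(x)-2nH_{n-1}(x)$ for $n\ge1$. They are orthogonal on $\mathbb{R}$ with respect to $e^{-x^2}$, with $\int_{-\infty}^{\infty}H_n(x)H_m(x)e^{-x^2}dx=\sqrt{\pi}\,2^n n!\,\delta_{nm}$. *)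

theory Defs
  imports "HOL-Analysis.Analysis" "HOL-Computational_Algebra.Polynomial"
begin

text \<open>Physicists' normalisation: the leading coefficient of \<open>hermite n\<close> is \<open>2 ^ n\<close>.\<close>

fun hermite :: "nat \<Rightarrow> real poly" where
  "hermite 0 = 1"
| "hermite (Suc 0) = [:0, 2:]"
| "hermite (Suc (Suc n)) =
     [:0, 2:] * hermite (Suc n) - smult (2 * real (Suc n)) (hermite n)"

definition beta_even :: "nat \<Rightarrow> real" where
  "beta_even n = (if odd n then 0 else real (n choose (n div 2)) / 2 ^ n)"

end

theory Submission
  imports Defs "HOL-Probability.Distributions"
begin

text \<open>
  Write \<open>Q\<^sub>n\<close> for the polynomial \<open>(H\<^sub>n(x) - H\<^sub>n(0)) / x\<close> and \<open>E p\<close> for the integral of \<open>p\<close>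
  against \<open>exp (- x\<^sup>2)\<close>. Subtracting from the three-term recurrence of the Hermite
  polynomials its value at the origin and dividing by \<open>x\<close> leaves
  \<open>Q\<^sub>n\<^sub>+\<^sub>2 = 2 H\<^sub>n\<^sub>+\<^sub>1 - 2 (n + 1) Q\<^sub>n\<close> (\<open>hermite_quotient_rec\<close>). Since \<open>Q\<^sub>n\<close> has degree less than
  \<open>n + 1\<close>, the two terms on the right are orthogonal, and Pythagoras gives
  \<open>E (Q\<^sub>n\<^sub>+\<^sub>2\<^sup>2) = 4 E (H\<^sub>n\<^sub>+\<^sub>1\<^sup>2) + 4 (n + 1)\<^sup>2 E (Q\<^sub>n\<^sup>2)\<close>
  (\<open>gauss_integral_hermite_quotient_square_rec\<close>).

  The claimed value satisfies the same two-step recursion, because the ratio of consecutive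
  central binomial coefficients gives \<open>(n + 2) \<beta>(n + 2) = (n + 1) \<beta>(n)\<close> (\<open>beta_even_rec\<close>). The
  induction starts from \<open>Q\<^sub>0 = 0\<close> and \<open>Q\<^sub>1 = 2\<close>.

  Orthogonality and the norms of the Hermite polynomials rest on integration by parts,
  \<open>E (2 x p) = E (p')\<close>. Together with the raising formula \<open>H\<^sub>n\<^sub>+\<^sub>1 = 2 x H\<^sub>n - H\<^sub>n'\<close> it yields
  \<open>E (H\<^sub>n\<^sub>+\<^sub>1 p) = E (H\<^sub>n p')\<close> (\<open>gauss_integral_hermite_Suc_mult\<close>), so that each index of \<open>H\<close>
  can be traded for one derivative of the other factor.
\<close>

section \<open>Integration of polynomials against the Gaussian weight\<close>

definition gauss_integral :: "real poly \<Rightarrow> real" where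
  "gauss_integral p = (LINT x|lborel. poly p x * exp (- x\<^sup>2))"

lemma has_bochner_integral_gauss_even:
  "has_bochner_integral lborel (\<lambda>x::real. x ^ (2 * k) * exp (- x\<^sup>2))
     (sqrt pi * (fact (2 * k) / (2 ^ (2 * k) * fact k)))"
  using has_bochner_integral_even_function[OF gaussian_moment_even_pos[of k]]
  by (simp add: mult.commute)

lemma has_bochner_integral_gauss_odd:
  "has_bochner_integral lborel (\<lambda>x::real. x ^ (2 * k + 1) * exp (- x\<^sup>2)) 0"
  using has_bochner_integral_odd_function[OF gaussian_moment_odd_pos[of k]]
  by (simp add: mult.commute)

lemma integrable_monomial_gauss: "integrable lborel (\<lambda>x::real. x ^ k * exp (- x\<^sup>2))"
proof (cases "even k")
  case True
  then obtain m where "k = 2 * m" by blast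
  then show ?thesis
    using has_bochner_integral_gauss_even[of m] by (simp add: has_bochner_integral_iff)
next
  case False
  then obtain m where "k = 2 * m + 1" by (rule oddE)
  then show ?thesis
    using has_bochner_integral_gauss_odd[of m] by (simp add: has_bochner_integral_iff)
qed

lemma integrable_poly_gauss: "integrable lborel (\<lambda>x::real. poly p x * exp (- x\<^sup>2))"
proof -
  have "(\<lambda>x. poly p x * exp (- x\<^sup>2)) =
      (\<lambda>x. \<Sum>i\<le>degree p. coeff p i * (x ^ i * exp (- x\<^sup>2)))"
    by (simp add: poly_altdef sum_distrib_right mult.assoc)
  then show ?thesis
    by (simp add: integrable_monomial_gauss)
qed

lemma gauss_integral_0 [simp]: "gauss_integral 0 = 0"
  by (simp add: gauss_integral_def)

lemma gauss_integral_1: "gauss_integral 1 = sqrt pi"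
  using has_bochner_integral_gauss_even[of 0]
  by (simp add: gauss_integral_def has_bochner_integral_iff)

lemma gauss_integral_add: "gauss_integral (p + q) = gauss_integral p + gauss_integral q"
  by (simp add: gauss_integral_def distrib_right integrable_poly_gauss)

lemma gauss_integral_diff: "gauss_integral (p - q) = gauss_integral p - gauss_integral q"
  by (simp add: gauss_integral_def left_diff_distrib integrable_poly_gauss)

lemma gauss_integral_smult: "gauss_integral (smult c p) = c * gauss_integral p"
  by (simp add: gauss_integral_def mult.assoc)

lemma gauss_integral_monom_even:
  "gauss_integral (monom 1 (2 * k)) = sqrt pi * (fact (2 * k) / (2 ^ (2 * k) * fact k))"
  using has_bochner_integral_gauss_even[of k]
  unfolding has_bochner_integral_iff gauss_integral_def poly_monom mult_1_left by (rule conjunct2)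

lemma gauss_integral_monom_odd: "gauss_integral (monom 1 (2 * k + 1)) = 0"
  using has_bochner_integral_gauss_odd[of k]
  unfolding has_bochner_integral_iff gauss_integral_def poly_monom mult_1_left by (rule conjunct2)

text \<open>
  The general formula is linear in the polynomial, so it is enough to compare the moments
  of order \<open>n + 1\<close> and \<open>n - 1\<close>: both vanish for even \<open>n\<close>, and for odd \<open>n\<close> their closed forms
  differ by the factor \<open>n / 2\<close>.
\<close>
lemma gauss_integral_by_parts_monom:
  "gauss_integral ([:0, 2:] * monom 1 n) = gauss_integral (pderiv (monom 1 n))"
proof -
  have mult: "[:0, 2:] * monom 1 n = smult 2 (monom (1::real) (n + 1))"
    by (simp add: monom_Suc)
  have deriv: "pderiv (monom (1::real) n) = smult (real n) (monom 1 (n - 1))"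
    by (simp add: pderiv_monom smult_monom)
  have "2 * gauss_integral (monom 1 (n + 1)) = real n * gauss_integral (monom 1 (n - 1))"
  proof (cases "even n")
    case True
    then obtain m where n: "n = 2 * m" by blast
    \<comment> \<open>For \<open>n = 0\<close> the truncated \<open>n - 1\<close> is \<open>0\<close>, an even exponent; there the factor \<open>n\<close> vanishes.\<close>
    have "real n * gauss_integral (monom 1 (n - 1)) = 0"
    proof (cases m)
      case (Suc j)
      then have "n - 1 = 2 * j + 1" by (simp add: n)
      then show ?thesis by (simp only: gauss_integral_monom_odd mult_zero_right)
    qed (simp add: n)
    then show ?thesis by (simp only: n gauss_integral_monom_odd mult_zero_right)
  next
    case False
    then obtain m where n: "n = 2 * m + 1" by (rule oddE)
    then have up: "n + 1 = 2 * Suc m" and down: "n - 1 = 2 * m" by simp_all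
    have "fact (2 * Suc m) = (real (2 * Suc m) * real n) * (fact (2 * m) :: real)"
      by (simp add: n algebra_simps)
    moreover have "2 ^ (2 * Suc m) * fact (Suc m) = real (2 * Suc m) * (2 * (2 ^ (2 * m) * fact m))"
      by (simp add: algebra_simps)
    ultimately have "2 * (fact (2 * Suc m) / (2 ^ (2 * Suc m) * fact (Suc m))) =
        real n * (fact (2 * m) / (2 ^ (2 * m) * fact m) :: real)"
      by (simp only: mult.assoc mult_divide_mult_cancel_left_if) (simp del: of_nat_Suc)
    then show ?thesis
      unfolding up down gauss_integral_monom_even by (simp only: mult.left_commute)
  qed
  then show ?thesis
    by (simp only: mult deriv gauss_integral_smult)
qed

text \<open>
  This says that \<open>(p(x) exp (- x\<^sup>2))' = (p'(x) - 2 x p(x)) exp (- x\<^sup>2)\<close> integrates to \<open>0\<close> over the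
  real line, there being no boundary terms at infinity.
\<close>
lemma gauss_integral_by_parts: "gauss_integral ([:0, 2:] * p) = gauss_integral (pderiv p)"
proof -
  have "gauss_integral ([:0, 2:] * (\<Sum>i\<le>n. smult (c i) (monom 1 i))) =
      gauss_integral (pderiv (\<Sum>i\<le>n. smult (c i) (monom 1 i)))" for c and n :: nat
    by (induction n)
      (simp_all only: sum.atMost_Suc distrib_left pderiv_add gauss_integral_add mult_smult_right
        pderiv_smult gauss_integral_smult gauss_integral_by_parts_monom atMost_0 sum.insert
        finite.emptyI sum.empty empty_iff not_False_eq_True add_0_right)
  from this[where c = "coeff p" and n = "degree p"] show ?thesis
    by (simp only: smult_monom mult_1_right poly_as_sum_of_monoms)
qed

section \<open>Orthogonality of the Hermite polynomials\<close>

text \<open>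
  Differentiating the recurrence produces \<open>2 H\<^sub>n\<^sub>+\<^sub>2\<close> from the factor \<open>2 x\<close>; by induction the
  two other terms are \<open>2 (n + 2)\<close> times the right-hand side of the recurrence for \<open>H\<^sub>n\<^sub>+\<^sub>2\<close>.
\<close>
lemma pderiv_hermite_Suc: "pderiv (hermite (Suc n)) = smult (2 * real (Suc n)) (hermite n)"
proof (induction n rule: hermite.induct)
  case 1
  show ?case by (simp add: pderiv_pCons)
next
  case 2
  show ?case by (simp add: pderiv_pCons)
next
  case (3 n)
  have "pderiv (hermite (Suc (Suc (Suc n)))) =
    smult 2 (hermite (Suc (Suc n))) + [:0, 2:] * pderiv (hermite (Suc (Suc n)))
      - smult (2 * real (Suc (Suc n))) (pderiv (hermite (Suc n)))"
    by (subst hermite.simps(3)) (simp only: pderiv_diff pderiv_mult pderiv_smult,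
      simp add: pderiv_pCons algebra_simps del: hermite.simps)
  also have "\<dots> = smult 2 (hermite (Suc (Suc n))) + smult (2 * real (Suc (Suc n)))
      ([:0, 2:] * hermite (Suc n) - smult (2 * real (Suc n)) (hermite n))"
    using 3 by (simp only: smult_diff_right mult_smult_right add_diff_eq)
  also have "\<dots> = smult 2 (hermite (Suc (Suc n))) + smult (2 * real (Suc (Suc n))) (hermite (Suc (Suc n)))"
    by (simp only: hermite.simps)
  also have "\<dots> = smult (2 * real (Suc (Suc (Suc n)))) (hermite (Suc (Suc n)))"
    by (simp only: smult_add_left[symmetric]) simp
  finally show ?case .
qed

lemma hermite_Suc: "hermite (Suc n) = [:0, 2:] * hermite n - pderiv (hermite n)"
proof (cases n)
  case (Suc m)
  then show ?thesis by (simp only: hermite.simps(3) pderiv_hermite_Suc)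
qed simp

text \<open>
  Raising the index of \<open>H\<close> is the adjoint of differentiation for the inner product \<open>E (p q)\<close>.
\<close>
lemma gauss_integral_hermite_Suc_mult:
  "gauss_integral (hermite (Suc n) * p) = gauss_integral (hermite n * pderiv p)"
proof -
  have "hermite (Suc n) * p = [:0, 2:] * (hermite n * p) - p * pderiv (hermite n)"
    by (simp only: hermite_Suc algebra_simps)
  then show ?thesis
    by (simp add: gauss_integral_diff del: mult_pCons_left)
      (simp only: gauss_integral_by_parts pderiv_mult gauss_integral_add)
qed

text \<open>
  Moving \<open>n\<close> derivatives onto \<open>p\<close> annihilates it when its degree is less than \<open>n\<close>.
\<close>
lemma hermite_orthogonal_lower_degree:
  assumes "degree p < n"
  shows "gauss_integral (hermite n * p) = 0"
  using assms
proof (induction n arbitrary: p)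
  case (Suc n)
  show ?case
  proof (cases "degree p = 0")
    case True
    then show ?thesis by (simp add: gauss_integral_hermite_Suc_mult pderiv_eq_0_iff[THEN iffD2])
  next
    case False
    with Suc.prems have "degree (pderiv p) < n" by (simp add: degree_pderiv)
    then show ?thesis by (simp only: gauss_integral_hermite_Suc_mult Suc.IH)
  qed
qed simp

text \<open>
  Each derivative moved onto the second factor lowers its index as well and contributes a
  factor \<open>2 n\<close>, until only \<open>E 1 = sqrt pi\<close> is left.
\<close>
lemma gauss_integral_hermite_square:
  "gauss_integral (hermite n * hermite n) = sqrt pi * 2 ^ n * fact n"
proof (induction n)
  case 0
  show ?case by (simp add: gauss_integral_1)
next
  case (Suc n)
  show ?case
    by (simp add: gauss_integral_hermite_Suc_mult pderiv_hermite_Suc gauss_integral_smult Suc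
        del: hermite.simps(3))
qed

lemma degree_hermite_le: "degree (hermite n) \<le> n"
proof (induction n)
  case (Suc n)
  have "degree ([:0, 2:] * hermite n) \<le> Suc n"
    using degree_mult_le[of "[:0, 2:]" "hermite n"] Suc by simp
  then show ?case
    using Suc by (simp only: hermite_Suc) (rule degree_diff_le, auto simp: degree_pderiv)
qed simp

section \<open>The difference quotient at the origin\<close>

text \<open>
  Synthetic division by \<open>x - 0\<close> gives the polynomial that continues the difference quotient
  to the origin.
\<close>
abbreviation hermite_quotient :: "nat \<Rightarrow> real poly" where
  "hermite_quotient n \<equiv> synthetic_div (hermite n) 0"

text \<open>
  In the recurrence for \<open>H\<^sub>n\<^sub>+\<^sub>2\<close> the term \<open>2 x H\<^sub>n\<^sub>+\<^sub>1\<close> has no constant part, so its quotient by \<open>x\<close> is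
  the whole of \<open>2 H\<^sub>n\<^sub>+\<^sub>1\<close>, while \<open>H\<^sub>n\<close> contributes its own difference quotient. Uniqueness of
  synthetic division identifies the result.
\<close>
lemma hermite_quotient_rec:
  "hermite_quotient (Suc (Suc n)) =
     smult 2 (hermite (Suc n)) - smult (2 * real (Suc n)) (hermite_quotient n)"
proof -
  have decomp: "pCons (poly (hermite n) 0) (hermite_quotient n) = hermite n"
    using synthetic_div_correct[of "hermite n" 0] by simp
  let ?r = "smult 2 (hermite (Suc n)) - smult (2 * real (Suc n)) (hermite_quotient n)"
  have "hermite (Suc (Suc n)) = pCons (- (2 * real (Suc n) * poly (hermite n) 0)) ?r"
    by (subst hermite.simps(3), subst decomp[symmetric]) (simp del: hermite.simps)
  then have "hermite (Suc (Suc n)) + smult 0 ?r =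
      pCons (- (2 * real (Suc n) * poly (hermite n) 0)) ?r"
    by (simp del: hermite.simps)
  from synthetic_div_unique[OF this] show ?thesis by metis
qed

lemma poly_hermite_quotient:
  assumes "x \<noteq> 0"
  shows "poly (hermite_quotient n) x = (poly (hermite n) x - poly (hermite n) 0) / x"
proof -
  have "poly (hermite n) x = x * poly (hermite_quotient n) x + poly (hermite n) 0"
    using arg_cong[OF synthetic_div_correct'[of 0 "hermite n"], of "\<lambda>p. poly p x"]
    by simp
  with assms show ?thesis by (simp add: field_simps)
qed

text \<open>
  The cross term in the square of \<open>2 H\<^sub>n\<^sub>+\<^sub>1 - 2 (n + 1) Q\<^sub>n\<close> integrates to zero, as \<open>Q\<^sub>n\<close> has too
  small a degree to see \<open>H\<^sub>n\<^sub>+\<^sub>1\<close>.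
\<close>
lemma gauss_integral_hermite_quotient_square_rec:
  "gauss_integral (hermite_quotient (Suc (Suc n)) * hermite_quotient (Suc (Suc n))) =
     4 * (sqrt pi * 2 ^ Suc n * fact (Suc n)) +
     (2 * real (Suc n))\<^sup>2 * gauss_integral (hermite_quotient n * hermite_quotient n)"
proof -
  let ?h = "hermite (Suc n)" and ?q = "hermite_quotient n" and ?c = "2 * real (Suc n)"
  have "degree ?q < Suc n"
    using degree_hermite_le[of n] by (simp add: degree_synthetic_div)
  then have orth: "gauss_integral (?h * ?q) = 0"
    by (rule hermite_orthogonal_lower_degree)
  have "hermite_quotient (Suc (Suc n)) * hermite_quotient (Suc (Suc n)) =
      smult 4 (?h * ?h) - smult (4 * ?c) (?h * ?q) + smult (?c\<^sup>2) (?q * ?q)"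
    unfolding hermite_quotient_rec
    by (simp add: algebra_simps power2_eq_square smult_add_left[symmetric] del: hermite.simps)
  then show ?thesis
    by (simp only: gauss_integral_add gauss_integral_diff gauss_integral_smult orth
        gauss_integral_hermite_square mult_zero_right diff_0_right)
qed

section \<open>Solving the recursion\<close>

text \<open>
  For even \<open>n = 2 k\<close> this is the ratio \<open>2 (2 k + 1) / (k + 1)\<close> of consecutive central binomial
  coefficients, rescaled by \<open>4\<close>; for odd \<open>n\<close> both sides are zero.
\<close>
lemma beta_even_rec: "real (n + 2) * beta_even (n + 2) = real (n + 1) * beta_even n"
proof (cases "even n")
  case True
  then obtain k where n: "n = 2 * k" by blast
  define b where "b j = real (2 * j choose j)" for j
  have fact_b: "fact (2 * j) = fact j * fact j * b j" for j :: nat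
    using binomial_fact[of j "2 * j", where 'a = real] by (simp add: b_def)
  \<comment> \<open>The identity \<open>(2 k + 2)! = (2 k + 2) (2 k + 1) (2 k)!\<close> written in terms of \<open>b\<close>.\<close>
  have "(real (Suc k) * fact k) * (real (Suc k) * fact k) * b (Suc k) =
      real (2 * Suc k) * real (2 * k + 1) * (fact k * fact k * b k)"
    using fact_b[of "Suc k"] unfolding fact_b[of k, symmetric] by (simp add: mult_ac)
  then have "(fact k * fact k * real (Suc k)) * (real (Suc k) * b (Suc k)) =
      (fact k * fact k * real (Suc k)) * (2 * real (2 * k + 1) * b k)"
    by (simp only: of_nat_mult of_nat_numeral mult_ac)
  then have rec: "real (Suc k) * b (Suc k) = 2 * real (2 * k + 1) * b k"
    unfolding mult_cancel_left by simp
  have "beta_even (2 * j) = b j / 4 ^ j" for j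
    by (simp add: beta_even_def b_def power_mult)
  from this[of k] this[of "Suc k"]
  have beta: "beta_even n = b k / 4 ^ k" "beta_even (n + 2) = b (Suc k) / 4 ^ Suc k"
    by (simp_all add: n)
  have "real (n + 2) * beta_even (n + 2) = 2 * (real (Suc k) * b (Suc k)) / 4 ^ Suc k"
    unfolding beta by (simp add: n field_simps)
  also have "\<dots> = real (n + 1) * beta_even n"
    unfolding rec beta by (simp add: n field_simps)
  finally show ?thesis .
qed (simp add: beta_even_def)

lemma gauss_integral_hermite_quotient_square:
  "gauss_integral (hermite_quotient n * hermite_quotient n) =
     sqrt pi * fact n * 2 ^ (n + 1) * (1 - beta_even n)"
proof (induction n rule: hermite.induct)
  case 1
  show ?case by (simp add: beta_even_def synthetic_div_eq_0_iff[THEN iffD2])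
next
  case 2
  have "hermite_quotient (Suc 0) * hermite_quotient (Suc 0) = smult 4 1"
    by simp
  then show ?case
    by (simp only: gauss_integral_smult gauss_integral_1) (simp add: beta_even_def)
next
  case (3 n)
  have beta: "real (n + 1) * beta_even n = real (n + 2) * beta_even (n + 2)"
    by (rule beta_even_rec[symmetric])
  have "gauss_integral (hermite_quotient (Suc (Suc n)) * hermite_quotient (Suc (Suc n))) =
     sqrt pi * 2 ^ (n + 3) * fact (n + 1) * (1 + real (n + 1) * (1 - beta_even n))"
    unfolding gauss_integral_hermite_quotient_square_rec 3
    by (simp add: algebra_simps power2_eq_square power_add)
  also have "1 + real (n + 1) * (1 - beta_even n) = real (n + 2) * (1 - beta_even (n + 2))"
    using beta by (simp add: algebra_simps)
  finally show ?case
    by (simp add: power_add mult_ac)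
qed

theorem theorem1p3:
  fixes n :: nat
  assumes "n > 0"
  shows "has_bochner_integral lborel
           (\<lambda>x::real. ((poly (hermite n) x - poly (hermite n) 0) / x)\<^sup>2 * exp (- x\<^sup>2))
           (sqrt pi * fact n * 2 ^ (n + 1) * (1 - beta_even n))"
proof -
  let ?q = "hermite_quotient n"
  have "has_bochner_integral lborel (\<lambda>x. poly (?q * ?q) x * exp (- x\<^sup>2))
      (sqrt pi * fact n * 2 ^ (n + 1) * (1 - beta_even n))"
    using integrable_poly_gauss[of "?q * ?q"] gauss_integral_hermite_quotient_square[of n]
    unfolding has_bochner_integral_iff gauss_integral_def by blast
  \<comment> \<open>At the origin the integrand takes the value \<open>0\<close> because of the division by zero, whereas the
    polynomial may not vanish there; a single point does not affect the integral.\<close>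
  moreover have "AE x in lborel. poly (?q * ?q) x * exp (- x\<^sup>2) =
      ((poly (hermite n) x - poly (hermite n) 0) / x)\<^sup>2 * exp (- x\<^sup>2)"
    using AE_lborel_singleton[of 0]
    by eventually_elim (simp add: poly_hermite_quotient power2_eq_square)
  moreover have [measurable]: "poly p \<in> borel_measurable borel" for p :: "real poly"
    by (intro borel_measurable_continuous_onI continuous_intros)
  ultimately show ?thesis
    by (subst has_bochner_integral_cong_AE[symmetric]) auto
qed

end
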